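(* A Leibniz algebra $\mathfrak{g}$ is quasi-Artinian if and only if there exists a two-sided ideal $I$ of $\mathfrak{g}$ such that $\mathfrak{g}/I$ is solvable and the sets of ideals $\{[\mathcal{H},I] : \mathcal{H}\lhd\mathfrak{g}\}$ and $\{[I,\mathcal{H}] : \mathcal{H}\lhd\mathfrak{g}\}$ both satisfy the minimal condition.
   Context: A (left) Leibniz algebra is a vector space $\mathfrak{g}$ (of arbitrary dimension) over a field with a bilinear bracket satisfying $[x,[y,z]]=[[x,y],z]+[y,[x,z]]$ for all $x,y,z$. "Ideal" means two-sided ideal; $\mathcal{H}\lhd\mathfrak{g}$ means that $\mathcal{H}$ is an ideal of $\mathfrak{g}$. For subspaces $A,B$, $[A,B]$ is the linear span of all $[a,b]$, $a\in A$, $b\in B$. The derived series is $\mathfrak{g}^{(0)}=\mathfrak{g}$, $\mathfrak{g}^{(n+1)}=[\mathfrak{g}^{(n)},\mathfrak{g}^{(n)}]$; $\mathfrak{g}$ is solvable if $\mathfrak{g}^{(n)}=0$ for some $n\in\mathbb{N}$. $\mathfrak{g}$ is left (resp. right) quasi-Artinian if for every descending chain of ideals $I_1\supseteq I_2\supseteq\cdots$ of $\mathfrak{g}$ there is $m\in\mathbb{N}$ such that $[\mathfrak{g}^{(m)},I_m]\subseteq I_n$ (resp. $[I_m,\mathfrak{g}^{(m)}]\subseteq I_n$) for all $n\in\mathbb{N}$; it is quasi-Artinian if it is both left and right quasi-Artinian. A set of subspaces satisfies the minimal condition if every descending chain of its members (with respect to inclusion) terminates, equivalently every non-empty subset has a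 minimal element. *)

theory Defs
  imports "HOL-Algebra.QuotRing" "HOL-Algebra.Module" "HOL.Hull"
begin

text \<open>
  As in the library locale \<^locale>\<open>algebra\<close>, the ring multiplication of the module record
  is the product of the algebra, here the bracket: \<open>x \<otimes>\<^bsub>G\<^esub> y\<close> is \<open>[x, y]\<close>. The field
  \<open>one\<close> of the record plays no role.
\<close>

locale leibniz_algebra = field R + module R G for R (structure) and G (structure) +
  assumes bracket_closed:
      "\<lbrakk>x \<in> carrier G; y \<in> carrier G\<rbrakk> \<Longrightarrow> x \<otimes>\<^bsub>G\<^esub> y \<in> carrier G"
    and bracket_add_left:
      "\<lbrakk>x \<in> carrier G; y \<in> carrier G; z \<in> carrier G\<rbrakk> \<Longrightarrow>
        (x \<oplus>\<^bsub>G\<^esub> y) \<otimes>\<^bsub>G\<^esub> z = (x \<otimes>\<^bsub>G\<^esub> z) \<oplus>\<^bsub>G\<^esub> (y \<otimes>\<^bsub>G\<^esub> z)"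
    and bracket_add_right:
      "\<lbrakk>x \<in> carrier G; y \<in> carrier G; z \<in> carrier G\<rbrakk> \<Longrightarrow>
        x \<otimes>\<^bsub>G\<^esub> (y \<oplus>\<^bsub>G\<^esub> z) = (x \<otimes>\<^bsub>G\<^esub> y) \<oplus>\<^bsub>G\<^esub> (x \<otimes>\<^bsub>G\<^esub> z)"
    and bracket_smult_left:
      "\<lbrakk>a \<in> carrier R; x \<in> carrier G; y \<in> carrier G\<rbrakk> \<Longrightarrow>
        (a \<odot>\<^bsub>G\<^esub> x) \<otimes>\<^bsub>G\<^esub> y = a \<odot>\<^bsub>G\<^esub> (x \<otimes>\<^bsub>G\<^esub> y)"
    and bracket_smult_right:
      "\<lbrakk>a \<in> carrier R; x \<in> carrier G; y \<in> carrier G\<rbrakk> \<Longrightarrow>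
        x \<otimes>\<^bsub>G\<^esub> (a \<odot>\<^bsub>G\<^esub> y) = a \<odot>\<^bsub>G\<^esub> (x \<otimes>\<^bsub>G\<^esub> y)"
    and leibniz_identity:
      "\<lbrakk>x \<in> carrier G; y \<in> carrier G; z \<in> carrier G\<rbrakk> \<Longrightarrow>
        x \<otimes>\<^bsub>G\<^esub> (y \<otimes>\<^bsub>G\<^esub> z) = ((x \<otimes>\<^bsub>G\<^esub> y) \<otimes>\<^bsub>G\<^esub> z) \<oplus>\<^bsub>G\<^esub> (y \<otimes>\<^bsub>G\<^esub> (x \<otimes>\<^bsub>G\<^esub> z))"

definition leibniz_ideal ::
    "('r, 'm) ring_scheme \<Rightarrow> ('r, 'a, 'n) module_scheme \<Rightarrow> 'a set \<Rightarrow> bool" where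
  "leibniz_ideal R G I \<longleftrightarrow> submodule I R G \<and>
    (\<forall>x\<in>carrier G. \<forall>y\<in>I. x \<otimes>\<^bsub>G\<^esub> y \<in> I \<and> y \<otimes>\<^bsub>G\<^esub> x \<in> I)"

definition linear_span ::
    "('r, 'm) ring_scheme \<Rightarrow> ('r, 'a, 'n) module_scheme \<Rightarrow> 'a set \<Rightarrow> 'a set" where
  "linear_span R G X = (\<lambda>U. submodule U R G) hull X"

definition bracket_span ::
    "('r, 'm) ring_scheme \<Rightarrow> ('r, 'a, 'n) module_scheme \<Rightarrow> 'a set \<Rightarrow> 'a set \<Rightarrow> 'a set" where
  "bracket_span R G A B = linear_span R G {a \<otimes>\<^bsub>G\<^esub> b | a b. a \<in> A \<and> b \<in> B}"

primrec derived_series ::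
    "('r, 'm) ring_scheme \<Rightarrow> ('r, 'a, 'n) module_scheme \<Rightarrow> nat \<Rightarrow> 'a set" where
  "derived_series R G 0 = carrier G"
| "derived_series R G (Suc n) = bracket_span R G (derived_series R G n) (derived_series R G n)"

definition leibniz_solvable ::
    "('r, 'm) ring_scheme \<Rightarrow> ('r, 'a, 'n) module_scheme \<Rightarrow> bool" where
  "leibniz_solvable R G \<longleftrightarrow> (\<exists>n. derived_series R G n = {\<zero>\<^bsub>G\<^esub>})"

text \<open>
  The quotient by an ideal \<open>I\<close>: its elements are the cosets of \<open>I\<close>, and its addition and bracket
  are those of the library's factor ring \<open>G Quot I\<close>, whose definition does not need \<open>G\<close> to be a
  ring. The scalar multiplication follows the pattern of \<^const>\<open>rcoset_mult\<close>.
\<close>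

definition leibniz_quotient ::
    "('r, 'a, 'n) module_scheme \<Rightarrow> 'a set \<Rightarrow> ('r, 'a set) module" where
  "leibniz_quotient G I = ring.extend (G Quot I)
    \<lparr>smult = (\<lambda>a X. \<Union>x\<in>X. I +>\<^bsub>G\<^esub> (a \<odot>\<^bsub>G\<^esub> x))\<rparr>"

lemma leibniz_quotient_simps:
  "carrier (leibniz_quotient G I) = a_rcosets\<^bsub>G\<^esub> I"
  "A \<oplus>\<^bsub>leibniz_quotient G I\<^esub> B = A <+>\<^bsub>G\<^esub> B"
  "\<zero>\<^bsub>leibniz_quotient G I\<^esub> = I"
  "A \<otimes>\<^bsub>leibniz_quotient G I\<^esub> B = rcoset_mult G I A B"
  "a \<odot>\<^bsub>leibniz_quotient G I\<^esub> A = (\<Union>x\<in>A. I +>\<^bsub>G\<^esub> (a \<odot>\<^bsub>G\<^esub> x))"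
  by (simp_all add: leibniz_quotient_def FactRing_def ring.extend_def)

lemma leibniz_algebra_quotient:
  fixes R (structure) and G (structure)
  assumes "leibniz_algebra R G" and "leibniz_ideal R G I"
  shows "leibniz_algebra R (leibniz_quotient G I)"
proof -
  interpret leibniz_algebra R G by fact
  have sub: "submodule I R G" and
    id: "\<And>x y. x \<in> carrier G \<Longrightarrow> y \<in> I \<Longrightarrow> x \<otimes>\<^bsub>G\<^esub> y \<in> I \<and> y \<otimes>\<^bsub>G\<^esub> x \<in> I"
    using assms(2) by (auto simp: leibniz_ideal_def)
  note subE = submoduleE[OF sub]
  interpret abelian_subgroup I G
    using sub by (intro abelian_subgroupI3)
      (auto simp: submodule_def intro: additive_subgroup.intro M.abelian_group_axioms abelian_group.intro M.abelian_monoid_axioms)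
  have smI: "a \<odot>\<^bsub>G\<^esub> x \<in> I" if "a \<in> carrier R" "x \<in> I" for a x using subE(4) that .
  have coset_eq: "I +>\<^bsub>G\<^esub> x = I +>\<^bsub>G\<^esub> y" if "x \<in> I +>\<^bsub>G\<^esub> y" "y \<in> carrier G" for x y
    using a_repr_independence[OF that(1) that(2) a_subgroup] by simp
  have mem: "z \<in> I +>\<^bsub>G\<^esub> y \<longleftrightarrow> (\<exists>h\<in>I. z = h \<oplus>\<^bsub>G\<^esub> y)" for z y
    by (auto simp: a_r_coset_def r_coset_def)
  have Ic: "h \<in> carrier G" if "h \<in> I" for h using subE(1) that by blast
  have sm: "(\<Union>z\<in>I +>\<^bsub>G\<^esub> x. I +>\<^bsub>G\<^esub> (a \<odot>\<^bsub>G\<^esub> z)) = I +>\<^bsub>G\<^esub> (a \<odot>\<^bsub>G\<^esub> x)"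
    if "a \<in> carrier R" "x \<in> carrier G" for a x
  proof -
    have "I +>\<^bsub>G\<^esub> (a \<odot>\<^bsub>G\<^esub> z) = I +>\<^bsub>G\<^esub> (a \<odot>\<^bsub>G\<^esub> x)" if "z \<in> I +>\<^bsub>G\<^esub> x" for z
    proof (rule coset_eq)
      from that obtain h where "h \<in> I" "z = h \<oplus>\<^bsub>G\<^esub> x" unfolding mem by blast
      then show "a \<odot>\<^bsub>G\<^esub> z \<in> I +>\<^bsub>G\<^esub> (a \<odot>\<^bsub>G\<^esub> x)"
        unfolding mem using smult_r_distr Ic smI \<open>a \<in> _\<close> \<open>x \<in> _\<close> by metis
    qed (use \<open>a \<in> _\<close> \<open>x \<in> _\<close> in simp)
    moreover have "x \<in> I +>\<^bsub>G\<^esub> x" using a_rcos_self that by blast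
    ultimately show ?thesis by blast
  qed
  have br: "rcoset_mult G I (I +>\<^bsub>G\<^esub> x) (I +>\<^bsub>G\<^esub> y) = I +>\<^bsub>G\<^esub> (x \<otimes>\<^bsub>G\<^esub> y)"
    if xy: "x \<in> carrier G" "y \<in> carrier G" for x y
  proof -
    have "I +>\<^bsub>G\<^esub> (u \<otimes>\<^bsub>G\<^esub> v) = I +>\<^bsub>G\<^esub> (x \<otimes>\<^bsub>G\<^esub> y)" if "u \<in> I +>\<^bsub>G\<^esub> x" "v \<in> I +>\<^bsub>G\<^esub> y" for u v
    proof (rule coset_eq)
      from that obtain h k where hk: "h \<in> I" "u = h \<oplus>\<^bsub>G\<^esub> x" "k \<in> I" "v = k \<oplus>\<^bsub>G\<^esub> y"
        unfolding mem by blast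
      have "u \<otimes>\<^bsub>G\<^esub> v = (h \<otimes>\<^bsub>G\<^esub> v \<oplus>\<^bsub>G\<^esub> x \<otimes>\<^bsub>G\<^esub> k) \<oplus>\<^bsub>G\<^esub> x \<otimes>\<^bsub>G\<^esub> y"
        using hk xy Ic bracket_closed
        by (simp add: bracket_add_left bracket_add_right M.a_ac)
      moreover have "h \<otimes>\<^bsub>G\<^esub> v \<oplus>\<^bsub>G\<^esub> x \<otimes>\<^bsub>G\<^esub> k \<in> I" using id hk xy Ic subE(5) by simp
      ultimately show "u \<otimes>\<^bsub>G\<^esub> v \<in> I +>\<^bsub>G\<^esub> (x \<otimes>\<^bsub>G\<^esub> y)" unfolding mem by blast
    qed (use xy bracket_closed in simp)
    moreover have "x \<in> I +>\<^bsub>G\<^esub> x" "y \<in> I +>\<^bsub>G\<^esub> y" using a_rcos_self xy by blast+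
    ultimately show ?thesis unfolding rcoset_mult_def by blast
  qed
  have cr: "A \<in> a_rcosets\<^bsub>G\<^esub> I \<longleftrightarrow> (\<exists>x\<in>carrier G. A = I +>\<^bsub>G\<^esub> x)" for A
    by (auto simp: A_RCOSETS_def')
  have zI: "I +>\<^bsub>G\<^esub> \<zero>\<^bsub>G\<^esub> = I" using a_subset by simp
  have ag: "abelian_group (leibniz_quotient G I)"
  proof (rule abelian_groupI)
    fix X assume "X \<in> carrier (leibniz_quotient G I)"
    then obtain x where x: "x \<in> carrier G" "X = I +>\<^bsub>G\<^esub> x" by (auto simp: leibniz_quotient_simps cr)
    then show "\<exists>Y\<in>carrier (leibniz_quotient G I). Y \<oplus>\<^bsub>leibniz_quotient G I\<^esub> X = \<zero>\<^bsub>leibniz_quotient G I\<^esub>"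
      by (intro bexI[of _ "I +>\<^bsub>G\<^esub> (\<ominus>\<^bsub>G\<^esub> x)"])
        (auto simp: leibniz_quotient_simps cr a_rcos_sum M.l_neg zI intro!: bexI[of _ "\<ominus>\<^bsub>G\<^esub> x"])
    show "\<zero>\<^bsub>leibniz_quotient G I\<^esub> \<oplus>\<^bsub>leibniz_quotient G I\<^esub> X = X"
      using a_rcos_sum[of "\<zero>\<^bsub>G\<^esub>" x] x by (simp add: leibniz_quotient_simps zI)
  next
    show "\<zero>\<^bsub>leibniz_quotient G I\<^esub> \<in> carrier (leibniz_quotient G I)"
      using zI by (auto simp: leibniz_quotient_simps cr)
  qed (auto simp: leibniz_quotient_simps cr a_rcos_sum M.a_ac)
  note qs = leibniz_quotient_simps(1-4)
  have smQ: "a \<odot>\<^bsub>leibniz_quotient G I\<^esub> (I +>\<^bsub>G\<^esub> x) = I +>\<^bsub>G\<^esub> (a \<odot>\<^bsub>G\<^esub> x)"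
    if "a \<in> carrier R" "x \<in> carrier G" for a x
    using sm[OF that] by (simp add: leibniz_quotient_simps)
  have md: "module R (leibniz_quotient G I)"
  proof (rule moduleI[OF cring_axioms ag], unfold qs)
    show "a \<odot>\<^bsub>leibniz_quotient G I\<^esub> X \<in> a_rcosets\<^bsub>G\<^esub> I"
      if "a \<in> carrier R" "X \<in> a_rcosets\<^bsub>G\<^esub> I" for a X
      using that smult_closed by (force simp: cr smQ)
  qed (auto simp: cr smQ a_rcos_sum smult_closed smult_l_distr smult_r_distr smult_assoc1)
  show ?thesis
  proof (intro leibniz_algebra.intro leibniz_algebra_axioms.intro md field_axioms, unfold qs)
    show "rcoset_mult G I X Y \<in> a_rcosets\<^bsub>G\<^esub> I"
      if "X \<in> a_rcosets\<^bsub>G\<^esub> I" "Y \<in> a_rcosets\<^bsub>G\<^esub> I" for X Y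
      using that bracket_closed by (force simp: cr br)
    show "rcoset_mult G I X (rcoset_mult G I Y Z) =
        rcoset_mult G I (rcoset_mult G I X Y) Z <+>\<^bsub>G\<^esub> rcoset_mult G I Y (rcoset_mult G I X Z)"
      if XYZ: "X \<in> a_rcosets\<^bsub>G\<^esub> I" "Y \<in> a_rcosets\<^bsub>G\<^esub> I" "Z \<in> a_rcosets\<^bsub>G\<^esub> I" for X Y Z
    proof -
      from XYZ obtain x y z where c: "x \<in> carrier G" "y \<in> carrier G" "z \<in> carrier G"
        and [simp]: "X = I +>\<^bsub>G\<^esub> x" "Y = I +>\<^bsub>G\<^esub> y" "Z = I +>\<^bsub>G\<^esub> z"
        unfolding cr by blast
      show ?thesis
        using leibniz_identity[OF c] c by (simp add: br bracket_closed a_rcos_sum)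
    qed
  qed (auto simp: cr smQ br smult_closed a_rcos_sum bracket_closed bracket_add_left
      bracket_add_right bracket_smult_left bracket_smult_right)
qed

text \<open>Chains of ideals are indexed from 1, so the values at index 0 are irrelevant.\<close>

definition descending_ideal_chain ::
    "('r, 'm) ring_scheme \<Rightarrow> ('r, 'a, 'n) module_scheme \<Rightarrow> (nat \<Rightarrow> 'a set) \<Rightarrow> bool" where
  "descending_ideal_chain R G I \<longleftrightarrow>
    (\<forall>n\<ge>1. leibniz_ideal R G (I n)) \<and> (\<forall>n\<ge>1. I (Suc n) \<subseteq> I n)"

definition left_quasi_artinian ::
    "('r, 'm) ring_scheme \<Rightarrow> ('r, 'a, 'n) module_scheme \<Rightarrow> bool" where
  "left_quasi_artinian R G \<longleftrightarrow> (\<forall>I. descending_ideal_chain R G I \<longrightarrow>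
    (\<exists>m\<ge>1. \<forall>n\<ge>1. bracket_span R G (derived_series R G m) (I m) \<subseteq> I n))"

definition right_quasi_artinian ::
    "('r, 'm) ring_scheme \<Rightarrow> ('r, 'a, 'n) module_scheme \<Rightarrow> bool" where
  "right_quasi_artinian R G \<longleftrightarrow> (\<forall>I. descending_ideal_chain R G I \<longrightarrow>
    (\<exists>m\<ge>1. \<forall>n\<ge>1. bracket_span R G (I m) (derived_series R G m) \<subseteq> I n))"

definition quasi_artinian ::
    "('r, 'm) ring_scheme \<Rightarrow> ('r, 'a, 'n) module_scheme \<Rightarrow> bool" where
  "quasi_artinian R G \<longleftrightarrow> left_quasi_artinian R G \<and> right_quasi_artinian R G"

definition minimal_condition :: "'a set set \<Rightarrow> bool" where
  "minimal_condition S \<longleftrightarrow> (\<forall>C :: nat \<Rightarrow> 'a set.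
    (\<forall>n. C n \<in> S) \<and> (\<forall>n. C (Suc n) \<subseteq> C n) \<longrightarrow> (\<exists>N. \<forall>n\<ge>N. C n = C N))"

end

theory Submission
  imports Defs
begin

text \<open>
  For the forward direction \<open>I\<close> is the stable term of the derived series, so that \<open>[I, I] = I\<close>.
  The difficulty is that \<open>[H, I]\<close> and \<open>[I, H]\<close> are left ideals but in general not right ideals,
  so the quasi-Artinian hypothesis does not apply to a chain \<open>C\<^sub>n\<close> of such subspaces directly.
  Let \<open>Z = {z. [z, x] = 0 for all x}\<close> be the left center. It contains all \<open>[x, y] + [y, x]\<close>, and
  hence \<open>C \<inter> Z\<close> and \<open>C + Z\<close> are two-sided ideals for every left ideal \<open>C\<close>. Since \<open>I\<close> is perfect,
  \<open>C\<^sub>m \<subseteq> [I, C\<^sub>m] + [C\<^sub>m, I]\<close>; the chain \<open>C\<^sub>n + Z\<close> then gives \<open>C\<^sub>m \<subseteq> C\<^sub>n + Z\<close> for large \<open>m\<close>, and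
  feeding this back together with the chain \<open>C\<^sub>n \<inter> Z\<close> gives \<open>C\<^sub>m \<subseteq> C\<^sub>n\<close>.
\<close>

section \<open>Submodules and linear spans\<close>

lemma (in module) submoduleI_smult:
  assumes "H \<subseteq> carrier M" "\<zero>\<^bsub>M\<^esub> \<in> H"
    and "\<And>a b. \<lbrakk>a \<in> H; b \<in> H\<rbrakk> \<Longrightarrow> a \<oplus>\<^bsub>M\<^esub> b \<in> H"
    and sm: "\<And>a x. \<lbrakk>a \<in> carrier R; x \<in> H\<rbrakk> \<Longrightarrow> a \<odot>\<^bsub>M\<^esub> x \<in> H"
  shows "submodule H R M"
proof (rule submoduleI)
  fix x assume x: "x \<in> H"
  then have "\<ominus>\<^bsub>M\<^esub> x = (\<ominus> \<one>) \<odot>\<^bsub>M\<^esub> x"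
    using assms(1) by (simp add: smult_l_minus subset_iff)
  then show "\<ominus>\<^bsub>M\<^esub> x \<in> H" using sm[of "\<ominus> \<one>" x] x by simp
qed (use assms in auto)

lemma (in module) submodule_zero: "submodule H R M \<Longrightarrow> \<zero>\<^bsub>M\<^esub> \<in> H"
  using subgroup.one_closed[of H "add_monoid M"] by (simp add: submodule_def)

lemma (in module) submodule_Inter:
  assumes "S \<noteq> {}" "\<And>U. U \<in> S \<Longrightarrow> submodule U R M"
  shows "submodule (\<Inter>S) R M"
proof (rule submoduleI_smult)
  show "\<Inter>S \<subseteq> carrier M" using assms submoduleE(1) by blast
  show "\<zero>\<^bsub>M\<^esub> \<in> \<Inter>S" using assms submodule_zero by blast
qed (use assms(2) submoduleE(4,5) in blast)+

lemma (in module) submodule_linear_span: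
  assumes "X \<subseteq> carrier M" shows "submodule (linear_span R M X) R M"
  unfolding linear_span_def hull_def
  by (rule submodule_Inter) (use assms carrier_is_submodule in auto)

lemma linear_span_minimal:
  "\<lbrakk>X \<subseteq> U; submodule U R M\<rbrakk> \<Longrightarrow> linear_span R M X \<subseteq> U"
  unfolding linear_span_def by (rule hull_minimal)

lemma linear_span_inc: "x \<in> X \<Longrightarrow> x \<in> linear_span R M X"
  unfolding linear_span_def by (rule hull_inc)

text \<open>Images and preimages of submodules under a linear map are submodules, so minimality of
  the span applies on each side. This carries the derived series over to a quotient.\<close>

lemma linear_span_image:
  assumes "module R M" "module R N"
    and pc: "\<And>x. x \<in> carrier M \<Longrightarrow> p x \<in> carrier N"
    and pa: "\<And>x y. \<lbrakk>x \<in> carrier M; y \<in> carrier M\<rbrakk> \<Longrightarrow> p (x \<oplus>\<^bsub>M\<^esub> y) = p x \<oplus>\<^bsub>N\<^esub> p y"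
    and ps: "\<And>a x. \<lbrakk>a \<in> carrier R; x \<in> carrier M\<rbrakk> \<Longrightarrow> p (a \<odot>\<^bsub>M\<^esub> x) = a \<odot>\<^bsub>N\<^esub> p x"
    and X: "X \<subseteq> carrier M"
  shows "p ` linear_span R M X = linear_span R N (p ` X)"
proof
  interpret M: module R M by fact
  interpret N: module R N by fact
  have "p \<zero>\<^bsub>M\<^esub> \<oplus>\<^bsub>N\<^esub> p \<zero>\<^bsub>M\<^esub> = p \<zero>\<^bsub>M\<^esub>" using pa[of "\<zero>\<^bsub>M\<^esub>" "\<zero>\<^bsub>M\<^esub>"] by simp
  then have p0: "p \<zero>\<^bsub>M\<^esub> = \<zero>\<^bsub>N\<^esub>" using pc N.add.r_cancel_one M.M.zero_closed by metis
  have sM: "submodule (linear_span R M X) R M" using M.submodule_linear_span X .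
  note eM = M.submoduleE[OF sM]
  have "submodule (p ` linear_span R M X) R N"
  proof (rule N.submoduleI_smult)
    show "p ` linear_span R M X \<subseteq> carrier N" using eM(1) pc by blast
    show "\<zero>\<^bsub>N\<^esub> \<in> p ` linear_span R M X" using M.submodule_zero[OF sM] p0 by force
  next
    fix a b assume "a \<in> p ` linear_span R M X" "b \<in> p ` linear_span R M X"
    then obtain x y where xy: "x \<in> linear_span R M X" "y \<in> linear_span R M X" "a = p x" "b = p y"
      by blast
    then have "a \<oplus>\<^bsub>N\<^esub> b = p (x \<oplus>\<^bsub>M\<^esub> y)" using pa[of x y] subsetD[OF eM(1)] by simp
    then show "a \<oplus>\<^bsub>N\<^esub> b \<in> p ` linear_span R M X" using eM(5)[OF xy(1,2)] by (rule image_eqI)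
  next
    fix a b assume a: "a \<in> carrier R" and "b \<in> p ` linear_span R M X"
    then obtain x where x: "x \<in> linear_span R M X" "b = p x" by blast
    then have "a \<odot>\<^bsub>N\<^esub> b = p (a \<odot>\<^bsub>M\<^esub> x)" using ps[of a x] subsetD[OF eM(1)] a by simp
    then show "a \<odot>\<^bsub>N\<^esub> b \<in> p ` linear_span R M X" using eM(4)[OF a x(1)] by (rule image_eqI)
  qed
  then show "linear_span R N (p ` X) \<subseteq> p ` linear_span R M X"
    by (intro linear_span_minimal image_mono) (auto intro: linear_span_inc)
  have pX: "p ` X \<subseteq> carrier N" using X pc by blast
  have sN: "submodule (linear_span R N (p ` X)) R N" using N.submodule_linear_span pX .
  have "submodule {x \<in> carrier M. p x \<in> linear_span R N (p ` X)} R M"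
    by (rule M.submoduleI_smult)
      (use N.submoduleE(4,5)[OF sN] N.submodule_zero[OF sN] p0 pa ps in auto)
  moreover have "X \<subseteq> {x \<in> carrier M. p x \<in> linear_span R N (p ` X)}"
    using X linear_span_inc[of _ "p ` X"] by blast
  ultimately have "linear_span R M X \<subseteq> {x \<in> carrier M. p x \<in> linear_span R N (p ` X)}"
    by (intro linear_span_minimal)
  then show "p ` linear_span R M X \<subseteq> linear_span R N (p ` X)" by blast
qed

section \<open>Ideals, brackets of subspaces and the derived series\<close>

lemma leibniz_idealD:
  assumes "leibniz_ideal R G A"
  shows "submodule A R G"
    and "\<And>x y. \<lbrakk>x \<in> carrier G; y \<in> A\<rbrakk> \<Longrightarrow> x \<otimes>\<^bsub>G\<^esub> y \<in> A"
    and "\<And>x y. \<lbrakk>x \<in> carrier G; y \<in> A\<rbrakk> \<Longrightarrow> y \<otimes>\<^bsub>G\<^esub> x \<in> A"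
  using assms by (auto simp: leibniz_ideal_def)

lemma bracket_span_minimal:
  assumes "submodule U R G" "\<And>a b. \<lbrakk>a \<in> A; b \<in> B\<rbrakk> \<Longrightarrow> a \<otimes>\<^bsub>G\<^esub> b \<in> U"
  shows "bracket_span R G A B \<subseteq> U"
  unfolding bracket_span_def by (rule linear_span_minimal) (use assms in auto)

lemma bracket_span_inc:
  "\<lbrakk>a \<in> A; b \<in> B\<rbrakk> \<Longrightarrow> a \<otimes>\<^bsub>G\<^esub> b \<in> bracket_span R G A B"
  unfolding bracket_span_def by (rule linear_span_inc) auto

context leibniz_algebra
begin

lemma submodule_bracket_span:
  assumes "A \<subseteq> carrier G" "B \<subseteq> carrier G"
  shows "submodule (bracket_span R G A B) R G"
  unfolding bracket_span_def
  by (rule submodule_linear_span) (use assms bracket_closed in auto)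

lemma leibniz_ideal_carrier: "leibniz_ideal R G A \<Longrightarrow> A \<subseteq> carrier G"
  using leibniz_idealD(1) submoduleE(1) by blast

lemma bracket_zero_left: "x \<in> carrier G \<Longrightarrow> \<zero>\<^bsub>G\<^esub> \<otimes>\<^bsub>G\<^esub> x = \<zero>\<^bsub>G\<^esub>"
  using bracket_add_left[of "\<zero>\<^bsub>G\<^esub>" "\<zero>\<^bsub>G\<^esub>" x] bracket_closed[of "\<zero>\<^bsub>G\<^esub>" x]
  by (metis M.l_zero M.zero_closed M.add.r_cancel_one)

lemma bracket_zero_right: "x \<in> carrier G \<Longrightarrow> x \<otimes>\<^bsub>G\<^esub> \<zero>\<^bsub>G\<^esub> = \<zero>\<^bsub>G\<^esub>"
  using bracket_add_right[of x "\<zero>\<^bsub>G\<^esub>" "\<zero>\<^bsub>G\<^esub>"] bracket_closed[of x "\<zero>\<^bsub>G\<^esub>"]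
  by (metis M.l_zero M.zero_closed M.add.r_cancel_one)

lemma submodule_left_preimage:
  assumes "submodule U R G" "x \<in> carrier G"
  shows "submodule {u \<in> carrier G. x \<otimes>\<^bsub>G\<^esub> u \<in> U} R G"
  by (rule submoduleI_smult)
    (use assms submoduleE(4,5)[OF assms(1)] submodule_zero[OF assms(1)] in
      \<open>auto simp: bracket_zero_right bracket_add_right bracket_smult_right\<close>)

lemma submodule_right_preimage:
  assumes "submodule U R G" "x \<in> carrier G"
  shows "submodule {u \<in> carrier G. u \<otimes>\<^bsub>G\<^esub> x \<in> U} R G"
  by (rule submoduleI_smult)
    (use assms submoduleE(4,5)[OF assms(1)] submodule_zero[OF assms(1)] in
      \<open>auto simp: bracket_zero_left bracket_add_left bracket_smult_left\<close>)

text \<open>The elements that \<open>[x, _]\<close> sends into \<open>U\<close> form a submodule, so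
  checking the generators \<open>[a, b]\<close> of the span suffices.\<close>

lemma bracket_left_in_submodule:
  assumes "submodule U R G" "x \<in> carrier G" "A \<subseteq> carrier G" "B \<subseteq> carrier G"
    and "\<And>a b. \<lbrakk>a \<in> A; b \<in> B\<rbrakk> \<Longrightarrow> x \<otimes>\<^bsub>G\<^esub> (a \<otimes>\<^bsub>G\<^esub> b) \<in> U"
    and "u \<in> bracket_span R G A B"
  shows "x \<otimes>\<^bsub>G\<^esub> u \<in> U"
  using bracket_span_minimal[OF submodule_left_preimage[OF assms(1,2)], of A B]
    assms bracket_closed by blast

lemma bracket_right_in_submodule:
  assumes "submodule U R G" "x \<in> carrier G" "A \<subseteq> carrier G" "B \<subseteq> carrier G"
    and "\<And>a b. \<lbrakk>a \<in> A; b \<in> B\<rbrakk> \<Longrightarrow> (a \<otimes>\<^bsub>G\<^esub> b) \<otimes>\<^bsub>G\<^esub> x \<in> U"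
    and "u \<in> bracket_span R G A B"
  shows "u \<otimes>\<^bsub>G\<^esub> x \<in> U"
  using bracket_span_minimal[OF submodule_right_preimage[OF assms(1,2)], of A B]
    assms bracket_closed by blast

text \<open>The Leibniz identity solved for the left-nested bracket: a right bracket on a product
  becomes a difference of left brackets. It replaces a derivation rule on the right.\<close>

lemma leibniz_identity_right:
  assumes "x \<in> carrier G" "y \<in> carrier G" "z \<in> carrier G"
  shows "(x \<otimes>\<^bsub>G\<^esub> y) \<otimes>\<^bsub>G\<^esub> z = x \<otimes>\<^bsub>G\<^esub> (y \<otimes>\<^bsub>G\<^esub> z) \<ominus>\<^bsub>G\<^esub> y \<otimes>\<^bsub>G\<^esub> (x \<otimes>\<^bsub>G\<^esub> z)"
  using leibniz_identity[OF assms] assms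
  by (simp add: bracket_closed M.minus_eq M.a_assoc M.r_neg)

lemma submodule_diff:
  "\<lbrakk>submodule U R G; a \<in> U; b \<in> U\<rbrakk> \<Longrightarrow> a \<ominus>\<^bsub>G\<^esub> b \<in> U"
  by (simp add: M.minus_eq submoduleE)

text \<open>\<open>[x, _]\<close> is a derivation:
  \<open>[x, [a, b]] = [[x, a], b] + [a, [x, b]]\<close>, with \<open>[x, a]\<close> still in
  \<open>A\<close> and \<open>[x, b]\<close> in \<open>B\<close>. From the right,
  \<open>[[a, b], x]\<close> produces a term \<open>[b, [a, x]]\<close> with the factors swapped,
  which for different ideals may leave the span.\<close>

lemma bracket_span_left_ideal:
  assumes A: "leibniz_ideal R G A" and B: "leibniz_ideal R G B"
    and "x \<in> carrier G" "u \<in> bracket_span R G A B"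
  shows "x \<otimes>\<^bsub>G\<^esub> u \<in> bracket_span R G A B"
proof (rule bracket_left_in_submodule[OF _ assms(3) _ _ _ assms(4)])
  note c = leibniz_ideal_carrier[OF A] leibniz_ideal_carrier[OF B]
  show s: "submodule (bracket_span R G A B) R G" using c by (rule submodule_bracket_span)
  fix a b assume ab: "a \<in> A" "b \<in> B"
  then have "(x \<otimes>\<^bsub>G\<^esub> a) \<otimes>\<^bsub>G\<^esub> b \<oplus>\<^bsub>G\<^esub> a \<otimes>\<^bsub>G\<^esub> (x \<otimes>\<^bsub>G\<^esub> b) \<in> bracket_span R G A B"
    by (intro submoduleE(5)[OF s] bracket_span_inc leibniz_idealD(2)[OF A] leibniz_idealD(2)[OF B]
        assms(3))
  then show "x \<otimes>\<^bsub>G\<^esub> (a \<otimes>\<^bsub>G\<^esub> b) \<in> bracket_span R G A B"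
    using leibniz_identity[of x a b] ab c assms(3) by (simp add: subset_iff)
qed (use A B leibniz_ideal_carrier in auto)

text \<open>With equal factors the swapped term \<open>[b, [a, x]]\<close> of the right bracket
  falls into \<open>[A, A]\<close> again, which gives closure on the right.\<close>

lemma leibniz_ideal_bracket_span_self:
  assumes A: "leibniz_ideal R G A" shows "leibniz_ideal R G (bracket_span R G A A)"
proof -
  note c = leibniz_ideal_carrier[OF A]
  have s: "submodule (bracket_span R G A A) R G" using c c by (rule submodule_bracket_span)
  have "u \<otimes>\<^bsub>G\<^esub> x \<in> bracket_span R G A A" if x: "x \<in> carrier G" and u: "u \<in> bracket_span R G A A" for x u
  proof (rule bracket_right_in_submodule[OF s x c c _ u])
    fix a b assume ab: "a \<in> A" "b \<in> A"
    then have "a \<otimes>\<^bsub>G\<^esub> (b \<otimes>\<^bsub>G\<^esub> x) \<ominus>\<^bsub>G\<^esub> b \<otimes>\<^bsub>G\<^esub> (a \<otimes>\<^bsub>G\<^esub> x) \<in> bracket_span R G A A"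
      by (intro submodule_diff[OF s] bracket_span_inc leibniz_idealD(3)[OF A] x)
    then show "(a \<otimes>\<^bsub>G\<^esub> b) \<otimes>\<^bsub>G\<^esub> x \<in> bracket_span R G A A"
      using leibniz_identity_right[of a b x] ab c x by (simp add: subset_iff)
  qed
  then show ?thesis unfolding leibniz_ideal_def
    using s bracket_span_left_ideal[OF A A] by blast
qed

lemma leibniz_ideal_derived_series: "leibniz_ideal R G (derived_series R G n)"
proof (induction n)
  case 0
  then show ?case by (simp add: leibniz_ideal_def carrier_is_submodule bracket_closed)
qed (simp add: leibniz_ideal_bracket_span_self)

lemma bracket_span_subset_ideal_right:
  assumes "leibniz_ideal R G B" "A \<subseteq> carrier G" shows "bracket_span R G A B \<subseteq> B"
  by (rule bracket_span_minimal) (use assms leibniz_idealD[OF assms(1)] in auto)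

lemma bracket_span_subset_ideal_left:
  assumes "leibniz_ideal R G A" "B \<subseteq> carrier G" shows "bracket_span R G A B \<subseteq> A"
  by (rule bracket_span_minimal) (use assms leibniz_idealD[OF assms(1)] in auto)

lemma derived_series_Suc_subset: "derived_series R G (Suc n) \<subseteq> derived_series R G n"
  using bracket_span_subset_ideal_left leibniz_ideal_derived_series leibniz_ideal_carrier by simp

lemma derived_series_antimono: "m \<le> n \<Longrightarrow> derived_series R G n \<subseteq> derived_series R G m"
  by (rule lift_Suc_antimono_le[of "derived_series R G"]) (rule derived_series_Suc_subset)

text \<open>The derived series is itself a descending chain of ideals. For it the bracket in the
  quasi-Artinian condition is by definition \<open>derived_series R G (Suc m)\<close>, so this term
  lies in all later ones and \<open>k = Suc m\<close> works.\<close>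

lemma left_quasi_artinian_perfect:
  assumes "left_quasi_artinian R G"
  obtains k where "bracket_span R G (derived_series R G k) (derived_series R G k) = derived_series R G k"
    and "\<And>n. derived_series R G k \<subseteq> derived_series R G n"
proof -
  have "descending_ideal_chain R G (derived_series R G)"
    unfolding descending_ideal_chain_def
    using leibniz_ideal_derived_series derived_series_Suc_subset by blast
  then obtain m where m: "\<And>n. n \<ge> 1 \<Longrightarrow> derived_series R G (Suc m) \<subseteq> derived_series R G n"
    using assms unfolding left_quasi_artinian_def derived_series.simps by blast
  show thesis
  proof (rule that[of "Suc m"])
    have "derived_series R G (Suc (Suc m)) = derived_series R G (Suc m)"
      using m[of "Suc (Suc m)"] derived_series_Suc_subset[of "Suc m"] by auto
    then show "bracket_span R G (derived_series R G (Suc m)) (derived_series R G (Suc m)) =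
        derived_series R G (Suc m)" by simp
    \<comment> \<open>The chain condition covers only indices from 1 on; \<open>n = 0\<close> is
      reached through \<open>Suc n\<close>.\<close>
    show "derived_series R G (Suc m) \<subseteq> derived_series R G n" for n
      using order_trans[OF m[of "Suc n"] derived_series_Suc_subset[of n]] by linarith
  qed
qed

section \<open>The left center, and the two-sided ideals it makes out of left ideals\<close>

definition left_center :: "'c set" where
  "left_center = {z \<in> carrier G. \<forall>x\<in>carrier G. z \<otimes>\<^bsub>G\<^esub> x = \<zero>\<^bsub>G\<^esub>}"

lemma submodule_left_center: "submodule left_center R G"
  by (rule submoduleI_smult)
    (auto simp: left_center_def bracket_zero_left bracket_add_left bracket_smult_left)

text \<open>Expanding \<open>[[x, z], y]\<close> leaves \<open>[x, [z, y]]\<close> and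
  \<open>[z, [x, y]]\<close>; both vanish because \<open>z\<close> kills everything to its
  right.\<close>

lemma left_center_bracket:
  assumes x: "x \<in> carrier G" and z: "z \<in> left_center"
  shows "x \<otimes>\<^bsub>G\<^esub> z \<in> left_center"
  using assms leibniz_identity_right[of x z]
  by (auto simp: left_center_def bracket_closed bracket_zero_right M.minus_eq)

text \<open>Bracketing \<open>[x, y]\<close> and \<open>[y, x]\<close> with \<open>z\<close> on the
  right gives \<open>p - q\<close> and \<open>q - p\<close>, where \<open>p = [x, [y, z]]\<close>
  and \<open>q = [y, [x, z]]\<close>, so the sum cancels.\<close>

lemma symmetric_bracket_in_left_center:
  assumes "x \<in> carrier G" "y \<in> carrier G"
  shows "x \<otimes>\<^bsub>G\<^esub> y \<oplus>\<^bsub>G\<^esub> y \<otimes>\<^bsub>G\<^esub> x \<in> left_center"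
proof -
  have "(x \<otimes>\<^bsub>G\<^esub> y \<oplus>\<^bsub>G\<^esub> y \<otimes>\<^bsub>G\<^esub> x) \<otimes>\<^bsub>G\<^esub> z = \<zero>\<^bsub>G\<^esub>" if z: "z \<in> carrier G" for z
  proof -
    define p q where "p = x \<otimes>\<^bsub>G\<^esub> (y \<otimes>\<^bsub>G\<^esub> z)" and "q = y \<otimes>\<^bsub>G\<^esub> (x \<otimes>\<^bsub>G\<^esub> z)"
    have c: "p \<in> carrier G" "q \<in> carrier G" using assms z by (auto simp: p_def q_def bracket_closed)
    have "(x \<otimes>\<^bsub>G\<^esub> y \<oplus>\<^bsub>G\<^esub> y \<otimes>\<^bsub>G\<^esub> x) \<otimes>\<^bsub>G\<^esub> z = (p \<ominus>\<^bsub>G\<^esub> q) \<oplus>\<^bsub>G\<^esub> (q \<ominus>\<^bsub>G\<^esub> p)"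
      using assms z by (simp add: bracket_add_left bracket_closed leibniz_identity_right p_def q_def)
    also have "\<dots> = (p \<oplus>\<^bsub>G\<^esub> \<ominus>\<^bsub>G\<^esub> p) \<oplus>\<^bsub>G\<^esub> (q \<oplus>\<^bsub>G\<^esub> \<ominus>\<^bsub>G\<^esub> q)"
      using c by (simp only: M.minus_eq M.a_ac M.a_inv_closed M.a_closed)
    also have "\<dots> = \<zero>\<^bsub>G\<^esub>" using c by (simp add: M.r_neg)
    finally show ?thesis .
  qed
  then show ?thesis using assms by (auto simp: left_center_def bracket_closed)
qed

text \<open>Right brackets of left central elements are zero, so only closure on the left is at
  stake, and \<open>C\<close> and the left center both have it.\<close>

lemma leibniz_ideal_Int_left_center:
  assumes s: "submodule C R G" and l: "\<And>x c. \<lbrakk>x \<in> carrier G; c \<in> C\<rbrakk> \<Longrightarrow> x \<otimes>\<^bsub>G\<^esub> c \<in> C"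
  shows "leibniz_ideal R G (C \<inter> left_center)"
proof -
  have "submodule (C \<inter> left_center) R G"
    using submodule_Inter[of "{C, left_center}"] s submodule_left_center by auto
  moreover have "z \<otimes>\<^bsub>G\<^esub> x \<in> C \<inter> left_center" if "x \<in> carrier G" "z \<in> left_center" for x z
    using that submodule_zero[OF s] submodule_zero[OF submodule_left_center]
    by (simp add: left_center_def)
  ultimately show ?thesis unfolding leibniz_ideal_def using l left_center_bracket by blast
qed

definition add_left_center :: "'c set \<Rightarrow> 'c set" where
  "add_left_center C = {c \<oplus>\<^bsub>G\<^esub> z | c z. c \<in> C \<and> z \<in> left_center}"

lemma subset_add_left_center:
  assumes "submodule C R G" shows "C \<subseteq> add_left_center C"
proof
  fix c assume c: "c \<in> C"
  then have "c = c \<oplus>\<^bsub>G\<^esub> \<zero>\<^bsub>G\<^esub>" using submoduleE(1)[OF assms] by auto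
  then show "c \<in> add_left_center C"
    unfolding add_left_center_def using c submodule_zero[OF submodule_left_center] by blast
qed

text \<open>For \<open>c \<in> C\<close>, the bracket \<open>[c, x]\<close> is
  \<open>-[x, c]\<close>, an element of \<open>C\<close>, plus the left central
  \<open>[x, c] + [c, x]\<close>. Antisymmetry up to the left center thus turns closure on the left
  into closure on the right; a left central summand \<open>z\<close> contributes
  \<open>[z, x] = 0\<close>.\<close>

lemma leibniz_ideal_add_left_center:
  assumes s: "submodule C R G" and l: "\<And>x c. \<lbrakk>x \<in> carrier G; c \<in> C\<rbrakk> \<Longrightarrow> x \<otimes>\<^bsub>G\<^esub> c \<in> C"
  shows "leibniz_ideal R G (add_left_center C)"
proof -
  note sC = submoduleE[OF s] and sZ = submoduleE[OF submodule_left_center]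
  have cC: "c \<in> carrier G" if "c \<in> C" for c using that sC(1) by blast
  have cZ: "z \<in> carrier G" if "z \<in> left_center" for z using that sZ(1) by blast
  have I: "c \<oplus>\<^bsub>G\<^esub> z \<in> add_left_center C" if "c \<in> C" "z \<in> left_center" for c z
    unfolding add_left_center_def using that by blast
  have E: "\<exists>c z. u = c \<oplus>\<^bsub>G\<^esub> z \<and> c \<in> C \<and> z \<in> left_center" if "u \<in> add_left_center C" for u
    using that unfolding add_left_center_def by blast
  have sub: "submodule (add_left_center C) R G"
  proof (rule submoduleI_smult)
    show "add_left_center C \<subseteq> carrier G" using E cC cZ by blast
    show "\<zero>\<^bsub>G\<^esub> \<in> add_left_center C" using subset_add_left_center[OF s] submodule_zero[OF s] by blast
  next
    fix u v assume "u \<in> add_left_center C" "v \<in> add_left_center C"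
    then obtain c z d w where h: "u = c \<oplus>\<^bsub>G\<^esub> z" "c \<in> C" "z \<in> left_center"
      "v = d \<oplus>\<^bsub>G\<^esub> w" "d \<in> C" "w \<in> left_center" using E by meson
    then have "u \<oplus>\<^bsub>G\<^esub> v = (c \<oplus>\<^bsub>G\<^esub> d) \<oplus>\<^bsub>G\<^esub> (z \<oplus>\<^bsub>G\<^esub> w)" using cC cZ by (simp add: M.a_ac)
    then show "u \<oplus>\<^bsub>G\<^esub> v \<in> add_left_center C" using I sC(5) sZ(5) h by metis
  next
    fix a u assume a: "a \<in> carrier R" and "u \<in> add_left_center C"
    then obtain c z where h: "u = c \<oplus>\<^bsub>G\<^esub> z" "c \<in> C" "z \<in> left_center" using E by meson
    then show "a \<odot>\<^bsub>G\<^esub> u \<in> add_left_center C"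
      using I sC(4) sZ(4) a cC cZ by (simp add: smult_r_distr)
  qed
  moreover have "x \<otimes>\<^bsub>G\<^esub> u \<in> add_left_center C" "u \<otimes>\<^bsub>G\<^esub> x \<in> add_left_center C"
    if x: "x \<in> carrier G" and "u \<in> add_left_center C" for x u
  proof -
    obtain c z where h: "u = c \<oplus>\<^bsub>G\<^esub> z" "c \<in> C" "z \<in> left_center" using E \<open>u \<in> _\<close> by meson
    then show "x \<otimes>\<^bsub>G\<^esub> u \<in> add_left_center C"
      using I l left_center_bracket x cC cZ by (simp add: bracket_add_right)
    have "u \<otimes>\<^bsub>G\<^esub> x = c \<otimes>\<^bsub>G\<^esub> x"
      using h x cC by (simp add: bracket_add_left left_center_def bracket_closed)
    also have "\<dots> = \<ominus>\<^bsub>G\<^esub> (x \<otimes>\<^bsub>G\<^esub> c) \<oplus>\<^bsub>G\<^esub> (x \<otimes>\<^bsub>G\<^esub> c \<oplus>\<^bsub>G\<^esub> c \<otimes>\<^bsub>G\<^esub> x)"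
      using h x cC by (simp add: bracket_closed M.r_neg1)
    also have "\<dots> \<in> add_left_center C"
      by (rule I[OF sC(3)[OF l[OF x h(2)]] symmetric_bracket_in_left_center[OF x cC[OF h(2)]]])
    finally show "u \<otimes>\<^bsub>G\<^esub> x \<in> add_left_center C" .
  qed
  ultimately show ?thesis unfolding leibniz_ideal_def by blast
qed

section \<open>Chains of brackets with a perfect ideal\<close>

text \<open>
  Used with \<open>J = I\<close> for chains \<open>[H\<^sub>n, I]\<close> and with \<open>J = {0}\<close> for chains \<open>[I, H\<^sub>n]\<close>, which need not
  be closed under right brackets with \<open>I\<close>.
\<close>
lemma quasi_artinian_chain_stable:
  assumes qa: "quasi_artinian R G"
    and I: "\<And>n. I \<subseteq> derived_series R G n" and J: "J \<subseteq> I"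
    and s: "\<And>n. submodule (C n) R G"
    and l: "\<And>n x c. \<lbrakk>x \<in> carrier G; c \<in> C n\<rbrakk> \<Longrightarrow> x \<otimes>\<^bsub>G\<^esub> c \<in> C n"
    and r: "\<And>n c x. \<lbrakk>c \<in> C n; x \<in> J\<rbrakk> \<Longrightarrow> c \<otimes>\<^bsub>G\<^esub> x \<in> C n"
    and dec: "\<And>n. C (Suc n) \<subseteq> C n"
    and gen: "\<And>n. C n \<subseteq> linear_span R G
      ({i \<otimes>\<^bsub>G\<^esub> c | i c. i \<in> I \<and> c \<in> C n} \<union> {c \<otimes>\<^bsub>G\<^esub> j | c j. c \<in> C n \<and> j \<in> J})"
  shows "\<exists>N. \<forall>n\<ge>N. C n = C N"
proof -
  have dec': "C n \<subseteq> C m" if "m \<le> n" for m n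
    using lift_Suc_antimono_le[of C] dec that by blast
  have Ic: "I \<subseteq> carrier G" using I[of 0] by simp
  have cC: "c \<in> carrier G" if "c \<in> C n" for c n using that submoduleE(1)[OF s] by blast
  \<comment> \<open>For the intersections the left condition is applied, as right brackets of left
    central elements vanish anyway; for the sums, both conditions.\<close>
  have "descending_ideal_chain R G (\<lambda>n. C n \<inter> left_center)"
    unfolding descending_ideal_chain_def
    using leibniz_ideal_Int_left_center[OF s l] dec by blast
  then obtain m1 where "m1 \<ge> 1" and m1: "\<And>n. n \<ge> 1 \<Longrightarrow>
      bracket_span R G (derived_series R G m1) (C m1 \<inter> left_center) \<subseteq> C n \<inter> left_center"
    using qa unfolding quasi_artinian_def left_quasi_artinian_def by blast
  have ch: "descending_ideal_chain R G (\<lambda>n. add_left_center (C n))"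
    unfolding descending_ideal_chain_def
    using leibniz_ideal_add_left_center[OF s l] dec unfolding add_left_center_def by blast
  then obtain m2 where "m2 \<ge> 1" and m2: "\<And>n. n \<ge> 1 \<Longrightarrow>
      bracket_span R G (derived_series R G m2) (add_left_center (C m2)) \<subseteq> add_left_center (C n)"
    using qa unfolding quasi_artinian_def left_quasi_artinian_def by blast
  obtain m3 where "m3 \<ge> 1" and m3: "\<And>n. n \<ge> 1 \<Longrightarrow>
      bracket_span R G (add_left_center (C m3)) (derived_series R G m3) \<subseteq> add_left_center (C n)"
    using qa ch unfolding quasi_artinian_def right_quasi_artinian_def by blast
  \<comment> \<open>The sum dominates \<open>m1\<close>, \<open>m2\<close> and \<open>m3\<close>, so
    \<open>C m\<close> lies in each corresponding term of \<open>C\<close>. It is also at least 1,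
    so every \<open>n \<ge> m\<close> is in the range of the three inclusions.\<close>
  define m where "m = m1 + m2 + m3"
  have "C m \<subseteq> C n" if n: "n \<ge> m" for n
  proof -
    have n1: "n \<ge> 1" using n \<open>m1 \<ge> 1\<close> by (simp add: m_def)
    \<comment> \<open>First pass, modulo the left center: generators \<open>[i, c]\<close> are
      handled by \<open>m2\<close> and \<open>[c, j]\<close> by \<open>m3\<close>, because
      \<open>I\<close> and \<open>J\<close> lie in every term of the derived series.\<close>
    have sub: "C m \<subseteq> add_left_center (C n)"
    proof (rule order_trans[OF gen linear_span_minimal])
      have "i \<otimes>\<^bsub>G\<^esub> c \<in> add_left_center (C n)" if "i \<in> I" "c \<in> C m" for i c
      proof -
        have "c \<in> add_left_center (C m2)"
          using that dec'[of m2 m] subset_add_left_center[OF s, of m2] by (simp add: m_def subset_iff)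
        then show ?thesis using m2[OF n1] I[of m2] that by (blast intro: bracket_span_inc)
      qed
      moreover have "c \<otimes>\<^bsub>G\<^esub> j \<in> add_left_center (C n)" if "j \<in> J" "c \<in> C m" for j c
      proof -
        have "c \<in> add_left_center (C m3)"
          using that dec'[of m3 m] subset_add_left_center[OF s, of m3] by (simp add: m_def subset_iff)
        then show ?thesis using m3[OF n1] I[of m3] J that by (blast intro: bracket_span_inc)
      qed
      ultimately show "{i \<otimes>\<^bsub>G\<^esub> c | i c. i \<in> I \<and> c \<in> C m} \<union> {c \<otimes>\<^bsub>G\<^esub> j | c j. c \<in> C m \<and> j \<in> J}
          \<subseteq> add_left_center (C n)" by blast
      show "submodule (add_left_center (C n)) R G"
        using leibniz_ideal_add_left_center[OF s l] leibniz_idealD(1) by blast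
    qed
    \<comment> \<open>The left central remainder \<open>z = c - d\<close> belongs to
      \<open>C m\<close> because \<open>d \<in> C n\<close> and \<open>C n \<subseteq> C m\<close>;
      this puts \<open>z\<close> within reach of \<open>m1\<close>.\<close>
    then have split: "\<exists>d z. c = d \<oplus>\<^bsub>G\<^esub> z \<and> d \<in> C n \<and> z \<in> C m \<inter> left_center" if c: "c \<in> C m" for c
    proof -
      obtain d z where dz: "c = d \<oplus>\<^bsub>G\<^esub> z" "d \<in> C n" "z \<in> left_center"
        using sub c unfolding add_left_center_def by blast
      have "z \<in> carrier G" using dz(3) by (simp add: left_center_def)
      then have "z = \<ominus>\<^bsub>G\<^esub> d \<oplus>\<^bsub>G\<^esub> c" using dz cC by (simp add: M.r_neg1)
      moreover have "d \<in> C m" using dz(2) dec'[OF n] by blast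
      ultimately have "z \<in> C m" using submoduleE(3,5)[OF s] c by metis
      then show ?thesis using dz by blast
    qed
    \<comment> \<open>Second pass, now exact: in \<open>[i, c] = [i, d] + [i, z]\<close> the first
      term is in the left ideal \<open>C n\<close>, the second by the choice of \<open>m1\<close>.
      In \<open>[c, j]\<close> the part \<open>[z, j]\<close> is zero, and \<open>[d, j]\<close> is
      covered by closure of \<open>C n\<close> under brackets with \<open>J\<close>.\<close>
    show "C m \<subseteq> C n"
    proof (rule order_trans[OF gen linear_span_minimal[OF _ s]])
      have "i \<otimes>\<^bsub>G\<^esub> c \<in> C n" if "i \<in> I" and c: "c \<in> C m" for i c
      proof -
        obtain d z where dz: "c = d \<oplus>\<^bsub>G\<^esub> z" "d \<in> C n" "z \<in> C m" "z \<in> left_center"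
          using split[OF c] by blast
        have "z \<in> C m1 \<inter> left_center" using dz dec'[of m1 m] by (simp add: m_def subset_iff)
        then have "i \<otimes>\<^bsub>G\<^esub> z \<in> C n"
          using m1[OF n1] I[of m1] \<open>i \<in> I\<close> by (blast intro: bracket_span_inc)
        moreover have "i \<in> carrier G" using Ic \<open>i \<in> I\<close> by blast
        ultimately show ?thesis
          using dz l cC submoduleE(5)[OF s] by (simp add: bracket_add_right)
      qed
      moreover have "c \<otimes>\<^bsub>G\<^esub> j \<in> C n" if "j \<in> J" and c: "c \<in> C m" for j c
      proof -
        obtain d z where dz: "c = d \<oplus>\<^bsub>G\<^esub> z" "d \<in> C n" "z \<in> C m" "z \<in> left_center"
          using split[OF c] by blast
        have "j \<in> carrier G" using Ic J \<open>j \<in> J\<close> by blast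
        then have "c \<otimes>\<^bsub>G\<^esub> j = d \<otimes>\<^bsub>G\<^esub> j"
          using dz cC by (simp add: bracket_add_left left_center_def bracket_closed)
        then show ?thesis using r dz(2) \<open>j \<in> J\<close> by simp
      qed
      ultimately show "{i \<otimes>\<^bsub>G\<^esub> c | i c. i \<in> I \<and> c \<in> C m} \<union> {c \<otimes>\<^bsub>G\<^esub> j | c j. c \<in> C m \<and> j \<in> J} \<subseteq> C n"
        by blast
    qed
  qed
  then show ?thesis using dec' by blast
qed

text \<open>Since \<open>I\<close> is perfect, \<open>[h, u]\<close> reduces to
  \<open>[h, [i, j]] = [[h, i], j] + [i, [h, j]]\<close>, where \<open>[h, i]\<close> and
  \<open>[h, j]\<close> are in \<open>C\<close>. This verifies the generation hypothesis of
  \<open>quasi_artinian_chain_stable\<close> for \<open>J = I\<close>.\<close>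

lemma bracket_span_right_perfect_subset:
  assumes H: "leibniz_ideal R G H" and I: "leibniz_ideal R G I" and P: "bracket_span R G I I = I"
  defines "C \<equiv> bracket_span R G H I"
  shows "C \<subseteq> linear_span R G
    ({i \<otimes>\<^bsub>G\<^esub> c | i c. i \<in> I \<and> c \<in> C} \<union> {c \<otimes>\<^bsub>G\<^esub> j | c j. c \<in> C \<and> j \<in> I})" (is "_ \<subseteq> linear_span R G ?X")
proof -
  note cH = leibniz_ideal_carrier[OF H] and cI = leibniz_ideal_carrier[OF I]
  have "C \<subseteq> carrier G" unfolding C_def using submoduleE(1)[OF submodule_bracket_span] cH cI .
  then have s: "submodule (linear_span R G ?X) R G"
    by (intro submodule_linear_span) (use cI bracket_closed in blast)
  \<comment> \<open>Only the outer \<open>C\<close> is unfolded; its occurrences in the generating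
    set stay folded.\<close>
  show ?thesis
  proof (rule ord_eq_le_trans[OF C_def[THEN meta_eq_to_obj_eq] bracket_span_minimal[OF s]])
    fix h u assume h: "h \<in> H" and "u \<in> I"
    then have u: "u \<in> bracket_span R G I I" using P by simp
    have hc: "h \<in> carrier G" using h cH by blast
    show "h \<otimes>\<^bsub>G\<^esub> u \<in> linear_span R G ?X"
    proof (rule bracket_left_in_submodule[OF s hc cI cI _ u])
      fix i j assume ij: "i \<in> I" "j \<in> I"
      have "h \<otimes>\<^bsub>G\<^esub> i \<in> C" "h \<otimes>\<^bsub>G\<^esub> j \<in> C" unfolding C_def using h ij by (auto intro: bracket_span_inc)
      then have "(h \<otimes>\<^bsub>G\<^esub> i) \<otimes>\<^bsub>G\<^esub> j \<oplus>\<^bsub>G\<^esub> i \<otimes>\<^bsub>G\<^esub> (h \<otimes>\<^bsub>G\<^esub> j) \<in> linear_span R G ?X"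
        using ij by (intro submoduleE(5)[OF s] linear_span_inc) auto
      then show "h \<otimes>\<^bsub>G\<^esub> (i \<otimes>\<^bsub>G\<^esub> j) \<in> linear_span R G ?X"
        using leibniz_identity[of h i j] hc ij cI by (simp add: subset_iff)
    qed
  qed
qed

text \<open>Both terms of \<open>[[i, j], h] = [i, [j, h]] - [j, [i, h]]\<close> have an element of
  \<open>I\<close> outermost on the left, so left brackets alone generate. Hence
  \<open>J = {0}\<close> suffices for chains \<open>[I, H n]\<close>.\<close>

lemma bracket_span_left_perfect_subset:
  assumes H: "leibniz_ideal R G H" and I: "leibniz_ideal R G I" and P: "bracket_span R G I I = I"
  shows "bracket_span R G I H \<subseteq> bracket_span R G I (bracket_span R G I H)" (is "_ \<subseteq> ?D")
proof (rule bracket_span_minimal)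
  note cH = leibniz_ideal_carrier[OF H] and cI = leibniz_ideal_carrier[OF I]
  show s: "submodule ?D R G"
    by (intro submodule_bracket_span cI submoduleE(1)[OF submodule_bracket_span] cH)
  fix u h assume "u \<in> I" and h: "h \<in> H"
  then have u: "u \<in> bracket_span R G I I" using P by simp
  have hc: "h \<in> carrier G" using h cH by blast
  show "u \<otimes>\<^bsub>G\<^esub> h \<in> ?D"
  proof (rule bracket_right_in_submodule[OF s hc cI cI _ u])
    fix i j assume ij: "i \<in> I" "j \<in> I"
    have "i \<otimes>\<^bsub>G\<^esub> (j \<otimes>\<^bsub>G\<^esub> h) \<ominus>\<^bsub>G\<^esub> j \<otimes>\<^bsub>G\<^esub> (i \<otimes>\<^bsub>G\<^esub> h) \<in> ?D"
      using ij h by (intro submodule_diff[OF s] bracket_span_inc)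
    then show "(i \<otimes>\<^bsub>G\<^esub> j) \<otimes>\<^bsub>G\<^esub> h \<in> ?D"
      using leibniz_identity_right[of i j h] hc ij cI by (simp add: subset_iff)
  qed
qed

lemma quasi_artinian_minimal_conditions:
  assumes qa: "quasi_artinian R G" and I: "leibniz_ideal R G I"
    and P: "bracket_span R G I I = I" and D: "\<And>n. I \<subseteq> derived_series R G n"
  shows "minimal_condition {bracket_span R G H I | H. leibniz_ideal R G H}"
    and "minimal_condition {bracket_span R G I H | H. leibniz_ideal R G H}"
proof -
  note cI = leibniz_ideal_carrier[OF I]
  show "minimal_condition {bracket_span R G H I | H. leibniz_ideal R G H}"
    unfolding minimal_condition_def
  proof (intro allI impI)
    fix C assume C: "(\<forall>n. C n \<in> {bracket_span R G H I | H. leibniz_ideal R G H}) \<and> (\<forall>n. C (Suc n) \<subseteq> C n)"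
    \<comment> \<open>The ideals \<open>H n\<close> are chosen term by term and need not decrease;
      only the chain \<open>C\<close> does.\<close>
    then have "\<exists>H. leibniz_ideal R G H \<and> C n = bracket_span R G H I" for n by blast
    then obtain H where H: "\<And>n. leibniz_ideal R G (H n)" "\<And>n. C n = bracket_span R G (H n) I" by metis
    show "\<exists>N. \<forall>n\<ge>N. C n = C N"
    proof (rule quasi_artinian_chain_stable[OF qa D order_refl])
      show "submodule (C n) R G" for n
        unfolding H(2) by (intro submodule_bracket_span cI leibniz_ideal_carrier H)
      show "x \<otimes>\<^bsub>G\<^esub> c \<in> C n" if "x \<in> carrier G" "c \<in> C n" for n x c
        using bracket_span_left_ideal[OF H(1) I] that unfolding H(2) .
      \<comment> \<open>\<open>c\<close> lies in \<open>[H n, I]\<close>, hence in the ideal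
        \<open>H n\<close>, so \<open>[c, x]\<close> is again one of the generators of
        \<open>[H n, I]\<close>.\<close>
      show "c \<otimes>\<^bsub>G\<^esub> x \<in> C n" if "c \<in> C n" "x \<in> I" for n c x
        using that bracket_span_subset_ideal_left[OF H(1) cI] unfolding H(2)
        by (intro bracket_span_inc) auto
      show "C (Suc n) \<subseteq> C n" for n using C by blast
      show "C n \<subseteq> linear_span R G
          ({i \<otimes>\<^bsub>G\<^esub> c | i c. i \<in> I \<and> c \<in> C n} \<union> {c \<otimes>\<^bsub>G\<^esub> j | c j. c \<in> C n \<and> j \<in> I})" for n
        using bracket_span_right_perfect_subset[OF H(1) I P] unfolding H(2) .
    qed
  qed
  show "minimal_condition {bracket_span R G I H | H. leibniz_ideal R G H}"
    unfolding minimal_condition_def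
  proof (intro allI impI)
    fix C assume C: "(\<forall>n. C n \<in> {bracket_span R G I H | H. leibniz_ideal R G H}) \<and> (\<forall>n. C (Suc n) \<subseteq> C n)"
    then have "\<exists>H. leibniz_ideal R G H \<and> C n = bracket_span R G I H" for n by blast
    then obtain H where H: "\<And>n. leibniz_ideal R G (H n)" "\<And>n. C n = bracket_span R G I (H n)" by metis
    have s: "submodule (C n) R G" for n
      unfolding H(2) by (intro submodule_bracket_span cI leibniz_ideal_carrier H)
    show "\<exists>N. \<forall>n\<ge>N. C n = C N"
    proof (rule quasi_artinian_chain_stable[OF qa D _ s])
      show "{\<zero>\<^bsub>G\<^esub>} \<subseteq> I" using submodule_zero leibniz_idealD(1)[OF I] by blast
      show "x \<otimes>\<^bsub>G\<^esub> c \<in> C n" if "x \<in> carrier G" "c \<in> C n" for n x c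
        using bracket_span_left_ideal[OF I H(1)] that unfolding H(2) .
      show "c \<otimes>\<^bsub>G\<^esub> x \<in> C n" if "c \<in> C n" "x \<in> {\<zero>\<^bsub>G\<^esub>}" for n c x
        using that submoduleE(1)[OF s, of n] submodule_zero[OF s, of n] bracket_zero_right[of c] by auto
      show "C (Suc n) \<subseteq> C n" for n using C by blast
      show "C n \<subseteq> linear_span R G
          ({i \<otimes>\<^bsub>G\<^esub> c | i c. i \<in> I \<and> c \<in> C n} \<union> {c \<otimes>\<^bsub>G\<^esub> j | c j. c \<in> C n \<and> j \<in> {\<zero>\<^bsub>G\<^esub>}})" for n
      proof -
        \<comment> \<open>The brackets \<open>[i, c]\<close> already generate; the second family
          only enlarges the generating set.\<close>
        have "C n \<subseteq> bracket_span R G I (C n)"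
          using bracket_span_left_perfect_subset[OF H(1) I P] unfolding H(2) .
        also have "\<dots> \<subseteq> linear_span R G
          ({i \<otimes>\<^bsub>G\<^esub> c | i c. i \<in> I \<and> c \<in> C n} \<union> {c \<otimes>\<^bsub>G\<^esub> j | c j. c \<in> C n \<and> j \<in> {\<zero>\<^bsub>G\<^esub>}})"
          unfolding bracket_span_def linear_span_def by (rule hull_mono) (rule Un_upper1)
        finally show ?thesis .
      qed
    qed
  qed
qed

section \<open>From the minimal conditions back to the quasi-Artinian property\<close>

lemma quasi_artinian_of_minimal_conditions:
  assumes I: "leibniz_ideal R G I" and k: "derived_series R G k \<subseteq> I"
    and ml: "minimal_condition {bracket_span R G H I | H. leibniz_ideal R G H}"
    and mr: "minimal_condition {bracket_span R G I H | H. leibniz_ideal R G H}"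
  shows "quasi_artinian R G"
proof -
  note cI = leibniz_ideal_carrier[OF I]
  \<comment> \<open>For large \<open>m\<close> and \<open>n \<ge> m\<close>, the bracket of the
    \<open>m\<close>-th derived term with \<open>K m\<close> lies in
    \<open>[I, K m] = [I, K n] \<subseteq> K n\<close>, and likewise on the other side. A single
    \<open>m\<close> serves both conditions.\<close>
  have main: "\<exists>m\<ge>1. \<forall>n\<ge>1. bracket_span R G (derived_series R G m) (K m) \<subseteq> K n \<and>
      bracket_span R G (K m) (derived_series R G m) \<subseteq> K n"
    if K: "descending_ideal_chain R G K" for K
  proof -
    \<comment> \<open>Chains of ideals start at index 1 and \<open>minimal_condition\<close> at 0,
      so the chain is shifted by \<open>Suc\<close> throughout.\<close>
    have id: "leibniz_ideal R G (K (Suc n))" for n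
      using K unfolding descending_ideal_chain_def by auto
    have dec: "K (Suc (Suc n)) \<subseteq> K (Suc n)" for n
      using K unfolding descending_ideal_chain_def by auto
    have mono: "bracket_span R G A B \<subseteq> bracket_span R G A' B'"
      if "A \<subseteq> A'" "B \<subseteq> B'" for A B A' B'
      unfolding bracket_span_def linear_span_def by (rule hull_mono) (use that in blast)
    have "\<exists>N. \<forall>n\<ge>N. bracket_span R G (K (Suc n)) I = bracket_span R G (K (Suc N)) I"
      by (rule ml[unfolded minimal_condition_def, rule_format]) (use id dec mono in blast)
    then obtain N1 where N1: "\<And>n. n \<ge> N1 \<Longrightarrow> bracket_span R G (K (Suc n)) I = bracket_span R G (K (Suc N1)) I"
      by blast
    have "\<exists>N. \<forall>n\<ge>N. bracket_span R G I (K (Suc n)) = bracket_span R G I (K (Suc N))"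
      by (rule mr[unfolded minimal_condition_def, rule_format]) (use id dec mono in blast)
    then obtain N2 where N2: "\<And>n. n \<ge> N2 \<Longrightarrow> bracket_span R G I (K (Suc n)) = bracket_span R G I (K (Suc N2))"
      by blast
    \<comment> \<open>From \<open>m\<close> on both bracket chains are constant and the derived
      series lies in \<open>I\<close>; the index finally used is \<open>Suc m\<close>.\<close>
    define m where "m = N1 + N2 + k"
    have D: "derived_series R G (Suc m) \<subseteq> I"
      using derived_series_antimono[of k "Suc m"] k by (simp add: m_def)
    have "bracket_span R G (derived_series R G (Suc m)) (K (Suc m)) \<subseteq> K (Suc n) \<and>
        bracket_span R G (K (Suc m)) (derived_series R G (Suc m)) \<subseteq> K (Suc n)" for n
    proof (cases "m \<le> n")
      case True
      then have e: "bracket_span R G I (K (Suc m)) = bracket_span R G I (K (Suc n))"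
        "bracket_span R G (K (Suc m)) I = bracket_span R G (K (Suc n)) I"
        using N1[of m] N1[of n] N2[of m] N2[of n] by (simp_all add: m_def)
      show ?thesis
        using mono[OF D order_refl, of "K (Suc m)"] mono[OF order_refl D, of "K (Suc m)"]
          bracket_span_subset_ideal_right[OF id cI, of n] bracket_span_subset_ideal_left[OF id cI, of n]
        unfolding e by blast
    next
      \<comment> \<open>Earlier terms of the chain contain \<open>K (Suc m)\<close>, which absorbs
        brackets as an ideal.\<close>
      case False
      then have "K (Suc m) \<subseteq> K (Suc n)"
        using lift_Suc_antimono_le[of "\<lambda>n. K (Suc n)", OF dec, of n m] by simp
      then show ?thesis
        using bracket_span_subset_ideal_right[OF id, of "derived_series R G (Suc m)" m]
          bracket_span_subset_ideal_left[OF id, of "derived_series R G (Suc m)" m] D cI by blast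
    qed
    then show ?thesis by (metis One_nat_def Suc_le_D le_add1 plus_1_eq_Suc)
  qed
  show ?thesis
    unfolding quasi_artinian_def left_quasi_artinian_def right_quasi_artinian_def
    using main by blast
qed

section \<open>The projection to the quotient and its effect on the derived series\<close>

lemma leibniz_quotient_hom:
  assumes I: "leibniz_ideal R G I"
  defines "p \<equiv> \<lambda>x. I +>\<^bsub>G\<^esub> x"
  shows "p ` carrier G = carrier (leibniz_quotient G I)"
    and "\<And>x y. \<lbrakk>x \<in> carrier G; y \<in> carrier G\<rbrakk> \<Longrightarrow> p (x \<oplus>\<^bsub>G\<^esub> y) = p x \<oplus>\<^bsub>leibniz_quotient G I\<^esub> p y"
    and "\<And>a x. \<lbrakk>a \<in> carrier R; x \<in> carrier G\<rbrakk> \<Longrightarrow> p (a \<odot>\<^bsub>G\<^esub> x) = a \<odot>\<^bsub>leibniz_quotient G I\<^esub> p x"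
    and "\<And>x y. \<lbrakk>x \<in> carrier G; y \<in> carrier G\<rbrakk> \<Longrightarrow> p (x \<otimes>\<^bsub>G\<^esub> y) = p x \<otimes>\<^bsub>leibniz_quotient G I\<^esub> p y"
    and "\<And>x. x \<in> carrier G \<Longrightarrow> p x = \<zero>\<^bsub>leibniz_quotient G I\<^esub> \<longleftrightarrow> x \<in> I"
proof -
  note sI = submoduleE[OF leibniz_idealD(1)[OF I]] and cI = leibniz_ideal_carrier[OF I]
  have sg: "subgroup I (add_monoid G)" using leibniz_idealD(1)[OF I] by (rule submodule.axioms)
  then interpret abelian_subgroup I G
    by (intro abelian_subgroupI3 additive_subgroup.intro M.abelian_group_axioms)
  have mem: "z \<in> p y \<longleftrightarrow> (\<exists>h\<in>I. z = h \<oplus>\<^bsub>G\<^esub> y)" for z y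
    by (auto simp: p_def a_r_coset_def r_coset_def)
  have self: "x \<in> p x" if "x \<in> carrier G" for x using a_rcos_self that by (simp add: p_def)
  have eq: "p z = p y" if "z \<in> p y" "y \<in> carrier G" for z y
    using a_repr_independence' that by (simp add: p_def)
  show "p ` carrier G = carrier (leibniz_quotient G I)"
    by (auto simp: p_def leibniz_quotient_simps A_RCOSETS_def')
  show "p (x \<oplus>\<^bsub>G\<^esub> y) = p x \<oplus>\<^bsub>leibniz_quotient G I\<^esub> p y" if "x \<in> carrier G" "y \<in> carrier G" for x y
    using that by (simp add: p_def leibniz_quotient_simps a_rcos_sum)
  show "p x = \<zero>\<^bsub>leibniz_quotient G I\<^esub> \<longleftrightarrow> x \<in> I" if "x \<in> carrier G" for x
    using that a_rcos_self a_rcos_const by (auto simp: p_def leibniz_quotient_simps)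
  show "p (a \<odot>\<^bsub>G\<^esub> x) = a \<odot>\<^bsub>leibniz_quotient G I\<^esub> p x" if a: "a \<in> carrier R" and x: "x \<in> carrier G" for a x
  proof -
    \<comment> \<open>The operations on cosets are unions over representatives; each union collapses
      because all its cosets agree.\<close>
    have "p (a \<odot>\<^bsub>G\<^esub> z) = p (a \<odot>\<^bsub>G\<^esub> x)" if "z \<in> p x" for z
    proof (rule eq)
      from that obtain h where "h \<in> I" "z = h \<oplus>\<^bsub>G\<^esub> x" unfolding mem by blast
      then show "a \<odot>\<^bsub>G\<^esub> z \<in> p (a \<odot>\<^bsub>G\<^esub> x)"
        unfolding mem using smult_r_distr sI(4) cI a x by (metis subsetD)
    qed (use a x in simp)
    then have "(\<Union>z\<in>p x. p (a \<odot>\<^bsub>G\<^esub> z)) = p (a \<odot>\<^bsub>G\<^esub> x)" using self[OF x] by blast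
    then show ?thesis by (simp add: leibniz_quotient_simps p_def)
  qed
  show "p (x \<otimes>\<^bsub>G\<^esub> y) = p x \<otimes>\<^bsub>leibniz_quotient G I\<^esub> p y" if x: "x \<in> carrier G" and y: "y \<in> carrier G" for x y
  proof -
    have "p (u \<otimes>\<^bsub>G\<^esub> v) = p (x \<otimes>\<^bsub>G\<^esub> y)" if "u \<in> p x" "v \<in> p y" for u v
    proof (rule eq)
      from that obtain h k where hk: "h \<in> I" "u = h \<oplus>\<^bsub>G\<^esub> x" "k \<in> I" "v = k \<oplus>\<^bsub>G\<^esub> y"
        unfolding mem by blast
      then have c: "h \<in> carrier G" "k \<in> carrier G" "v \<in> carrier G" using cI y by auto
      \<comment> \<open>Changing representatives alters \<open>[x, y]\<close> by
        \<open>[h, v] + [x, k]\<close>, which is in \<open>I\<close> because \<open>I\<close> is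
        two-sided.\<close>
      have "h \<otimes>\<^bsub>G\<^esub> v \<oplus>\<^bsub>G\<^esub> x \<otimes>\<^bsub>G\<^esub> k \<in> I"
        using hk c x by (intro sI(5) leibniz_idealD[OF I])
      moreover have "u \<otimes>\<^bsub>G\<^esub> v = (h \<otimes>\<^bsub>G\<^esub> v \<oplus>\<^bsub>G\<^esub> x \<otimes>\<^bsub>G\<^esub> k) \<oplus>\<^bsub>G\<^esub> x \<otimes>\<^bsub>G\<^esub> y"
        using hk c x y by (simp add: bracket_add_left bracket_add_right bracket_closed M.a_ac)
      ultimately show "u \<otimes>\<^bsub>G\<^esub> v \<in> p (x \<otimes>\<^bsub>G\<^esub> y)" unfolding mem by blast
    qed (use x y bracket_closed in simp)
    then have "(\<Union>u\<in>p x. \<Union>v\<in>p y. p (u \<otimes>\<^bsub>G\<^esub> v)) = p (x \<otimes>\<^bsub>G\<^esub> y)"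
      using self[OF x] self[OF y] by blast
    then show ?thesis by (simp add: leibniz_quotient_simps rcoset_mult_def p_def)
  qed
qed

text \<open>The projection preserves brackets and commutes with spans by
  \<open>linear_span_image\<close>, so the induction passes through each bracket span.\<close>

lemma derived_series_quotient:
  assumes I: "leibniz_ideal R G I"
  shows "derived_series R (leibniz_quotient G I) n = (\<lambda>x. I +>\<^bsub>G\<^esub> x) ` derived_series R G n"
proof (induction n)
  case 0
  then show ?case using leibniz_quotient_hom(1)[OF I] by simp
next
  case (Suc n)
  let ?Q = "leibniz_quotient G I" and ?p = "\<lambda>x. I +>\<^bsub>G\<^esub> x" and ?D = "derived_series R G n"
  note hom = leibniz_quotient_hom[OF I]
  interpret Q: leibniz_algebra R ?Q
    using leibniz_algebra_quotient leibniz_algebra_axioms I by blast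
  have D: "?D \<subseteq> carrier G" using leibniz_ideal_carrier leibniz_ideal_derived_series by blast
  have X: "{a \<otimes>\<^bsub>G\<^esub> b | a b. a \<in> ?D \<and> b \<in> ?D} \<subseteq> carrier G" using D bracket_closed by blast
  have "?p (a \<otimes>\<^bsub>G\<^esub> b) = ?p a \<otimes>\<^bsub>?Q\<^esub> ?p b" if "a \<in> ?D" "b \<in> ?D" for a b
    using hom(4) that D by blast
  then have img: "?p ` {a \<otimes>\<^bsub>G\<^esub> b | a b. a \<in> ?D \<and> b \<in> ?D} =
      {a \<otimes>\<^bsub>?Q\<^esub> b | a b. a \<in> ?p ` ?D \<and> b \<in> ?p ` ?D}"
    by (fastforce simp: image_iff)
  have "?p ` linear_span R G {a \<otimes>\<^bsub>G\<^esub> b | a b. a \<in> ?D \<and> b \<in> ?D} =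
      linear_span R ?Q (?p ` {a \<otimes>\<^bsub>G\<^esub> b | a b. a \<in> ?D \<and> b \<in> ?D})"
    by (rule linear_span_image[OF module_axioms Q.module_axioms _ hom(2,3) X]) (use hom(1) in blast)
  then show ?case by (simp add: Suc.IH bracket_span_def img)
qed

text \<open>The projection maps each derived term onto that of the quotient and has kernel
  \<open>I\<close>. This criterion lets the theorem be proved inside \<open>G\<close>.\<close>

lemma leibniz_solvable_quotient_iff:
  assumes I: "leibniz_ideal R G I"
  shows "leibniz_solvable R (leibniz_quotient G I) \<longleftrightarrow> (\<exists>n. derived_series R G n \<subseteq> I)"
proof -
  have "derived_series R (leibniz_quotient G I) n = {\<zero>\<^bsub>leibniz_quotient G I\<^esub>} \<longleftrightarrow>
      derived_series R G n \<subseteq> I" for n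
  proof -
    note id = leibniz_ideal_derived_series[of n]
    \<comment> \<open>\<open>submoduleE(2)\<close> gives nonemptiness, without which the image would
      be empty rather than zero.\<close>
    have "(\<lambda>x. I +>\<^bsub>G\<^esub> x) ` derived_series R G n = {\<zero>\<^bsub>leibniz_quotient G I\<^esub>} \<longleftrightarrow>
        (\<forall>x\<in>derived_series R G n. I +>\<^bsub>G\<^esub> x = \<zero>\<^bsub>leibniz_quotient G I\<^esub>)"
      using submoduleE(2)[OF leibniz_idealD(1)[OF id]] by auto
    also have "\<dots> \<longleftrightarrow> (\<forall>x\<in>derived_series R G n. x \<in> I)"
      by (rule ball_cong[OF refl]) (rule leibniz_quotient_hom(5)[OF I subsetD[OF leibniz_ideal_carrier[OF id]]])
    finally show ?thesis unfolding derived_series_quotient[OF I] by (simp add: subset_eq)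
  qed
  then show ?thesis by (simp add: leibniz_solvable_def)
qed

end

theorem proposition3p3:
  fixes R :: "('r, 'm) ring_scheme" and G :: "('r, 'a, 'n) module_scheme"
  assumes "leibniz_algebra R G"
  shows "quasi_artinian R G \<longleftrightarrow>
    (\<exists>I. leibniz_ideal R G I \<and>
         leibniz_solvable R (leibniz_quotient G I) \<and>
         minimal_condition {bracket_span R G H I | H. leibniz_ideal R G H} \<and>
         minimal_condition {bracket_span R G I H | H. leibniz_ideal R G H})"
proof -
  interpret leibniz_algebra R G by fact
  show ?thesis
  proof
    assume qa: "quasi_artinian R G"
    then obtain k
      where P: "bracket_span R G (derived_series R G k) (derived_series R G k) = derived_series R G k"
        and D: "\<And>n. derived_series R G k \<subseteq> derived_series R G n"
      using left_quasi_artinian_perfect unfolding quasi_artinian_def by metis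
    \<comment> \<open>The witness for \<open>I\<close> is the stable term
      \<open>derived_series R G k\<close>; its quotient is solvable because the series reaches it at
      step \<open>k\<close>.\<close>
    note id = leibniz_ideal_derived_series[of k]
    show "\<exists>I. leibniz_ideal R G I \<and> leibniz_solvable R (leibniz_quotient G I) \<and>
         minimal_condition {bracket_span R G H I | H. leibniz_ideal R G H} \<and>
         minimal_condition {bracket_span R G I H | H. leibniz_ideal R G H}"
      using id leibniz_solvable_quotient_iff[OF id] quasi_artinian_minimal_conditions[OF qa id P D]
      by blast
  next
    assume "\<exists>I. leibniz_ideal R G I \<and> leibniz_solvable R (leibniz_quotient G I) \<and>
         minimal_condition {bracket_span R G H I | H. leibniz_ideal R G H} \<and>
         minimal_condition {bracket_span R G I H | H. leibniz_ideal R G H}"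
    \<comment> \<open>Solvability of the quotient gives some \<open>k\<close> with
      \<open>derived_series R G k \<subseteq> I\<close>, the form in which the converse lemma uses
      it.\<close>
    then show "quasi_artinian R G"
      using leibniz_solvable_quotient_iff quasi_artinian_of_minimal_conditions by blast
  qed
qed

end
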